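(* Let $n \ge 1$ and let $\mathcal{L}$ be a subset of the Boolean lattice $\mathcal{L}_n$ of all subsets of $\{x_1,\ldots,x_n\}$. Then there exists a unique unmixed bipartite graph $G$ on $\{x_1,\ldots,x_n\}\cup\{y_1,\ldots,y_n\}$ (with bipartition classes $\{x_1,\ldots,x_n\}$ and $\{y_1,\ldots,y_n\}$, without isolated vertices, and with $\{x_i,y_i\}\in E(G)$ for all $i$) such that $\mathcal{L}=\mathcal{L}_G$ if and only if $\emptyset\in\mathcal{L}$, $\{x_1,\ldots,x_n\}\in\mathcal{L}$, and $\mathcal{L}$ is a sublattice of $\mathcal{L}_n$.
   Context: All graphs are finite with no loops, no multiple edges and no isolated vertices; $E(G)$ is the edge set of $G$. A vertex cover of $G$ is a subset $C$ of the vertex set such that every edge of $G$ has at least one endpoint in $C$; it is minimal if no proper subset of $C$ is a vertex cover. $G$ is unmixed if all its minimal vertex covers have the same cardinality. Bipartite graphs on $\{x_1,\ldots,x_n\}\cup\{y_1,\ldots,y_n\}$ have every edge of the form $\{x_i,y_j\}$. For an unmixed bipartite graph without isolated vertices the two classes have the same size and there is a perfect matching, and the standing convention is that the vertices are labelled so that $\{x_i,y_i\}\in E(G)$ for all $i=1,\ldots,n$. Under this convention, every minimal vertex cover of an unmixed bipartite graph $G$ has the form $C=\{x_{i_1},\ldots,x_{i_s},y_{i_{s+1}},\ldots,y_{i_n}\}$ with $\{i_1,\ldots,i_n\}=\{1,\ldots,n\}$; set $\overline{C}=\{x_{i_1},\ldots,x_{i_s}\}=C\cap\{x_1,\ldots,x_n\}$.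 $\mathcal{L}_n$ denotes the Boolean lattice on $\{x_1,\ldots,x_n\}$, i.e. the set of all subsets ordered by inclusion, with meet $\cap$ and join $\cup$; a sublattice is a subset closed under $\cap$ and $\cup$. Define $\mathcal{L}_G=\{\overline{C} \mid C \text{ is a minimal vertex cover of } G\}\subset\mathcal{L}_n$. *)

theory Defs
  imports Main
begin

text \<open>A graph is given by a vertex set \<open>V\<close> and a set \<open>E\<close> of unordered edges;
  requiring every edge to have exactly two elements rules out loops, and multiple edges
  cannot occur.\<close>

definition simple_graph :: "'a set \<Rightarrow> 'a set set \<Rightarrow> bool" where
  "simple_graph V E \<longleftrightarrow> finite V \<and> (\<forall>e\<in>E. e \<subseteq> V \<and> card e = 2)"

definition no_isolated_vertices :: "'a set \<Rightarrow> 'a set set \<Rightarrow> bool" where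
  "no_isolated_vertices V E \<longleftrightarrow> (\<forall>v\<in>V. \<exists>e\<in>E. v \<in> e)"

definition bipartition :: "'a set \<Rightarrow> 'a set set \<Rightarrow> 'a set \<Rightarrow> 'a set \<Rightarrow> bool" where
  "bipartition V E A B \<longleftrightarrow>
     A \<union> B = V \<and> A \<inter> B = {} \<and> (\<forall>e\<in>E. \<exists>a\<in>A. \<exists>b\<in>B. e = {a, b})"

definition vertex_cover :: "'a set \<Rightarrow> 'a set set \<Rightarrow> 'a set \<Rightarrow> bool" where
  "vertex_cover V E C \<longleftrightarrow> C \<subseteq> V \<and> (\<forall>e\<in>E. \<exists>v\<in>e. v \<in> C)"

definition minimal_vertex_cover :: "'a set \<Rightarrow> 'a set set \<Rightarrow> 'a set \<Rightarrow> bool" where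
  "minimal_vertex_cover V E C \<longleftrightarrow>
     vertex_cover V E C \<and> (\<forall>D. D \<subset> C \<longrightarrow> \<not> vertex_cover V E D)"

definition unmixed :: "'a set \<Rightarrow> 'a set set \<Rightarrow> bool" where
  "unmixed V E \<longleftrightarrow>
     (\<forall>C D. minimal_vertex_cover V E C \<and> minimal_vertex_cover V E D \<longrightarrow> card C = card D)"

text \<open>\<open>XV i\<close> and \<open>YV i\<close> stand for $x_i$ and $y_i$; only indices in
  \<open>{1..n}\<close> are used.\<close>

datatype vertex = XV nat | YV nat

definition x_class :: "nat \<Rightarrow> vertex set" where
  "x_class n = XV ` {1..n}"

definition y_class :: "nat \<Rightarrow> vertex set" where
  "y_class n = YV ` {1..n}"

definition vertices :: "nat \<Rightarrow> vertex set" where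
  "vertices n = x_class n \<union> y_class n"

text \<open>The vertex set is fixed by \<open>n\<close>, so a graph on it is determined by its edge set.\<close>

definition unmixed_bipartite_graph :: "nat \<Rightarrow> vertex set set \<Rightarrow> bool" where
  "unmixed_bipartite_graph n E \<longleftrightarrow>
     simple_graph (vertices n) E \<and>
     no_isolated_vertices (vertices n) E \<and>
     bipartition (vertices n) E (x_class n) (y_class n) \<and>
     (\<forall>i\<in>{1..n}. {XV i, YV i} \<in> E) \<and>
     unmixed (vertices n) E"

definition boolean_lattice :: "nat \<Rightarrow> vertex set set" where
  "boolean_lattice n = Pow (x_class n)"

definition sublattice :: "'a set set \<Rightarrow> 'a set set \<Rightarrow> bool" where
  "sublattice L M \<longleftrightarrow> L \<subseteq> M \<and> (\<forall>A\<in>L. \<forall>B\<in>L. A \<inter> B \<in> L \<and> A \<union> B \<in> L)"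

definition cover_lattice :: "nat \<Rightarrow> vertex set set \<Rightarrow> vertex set set" where
  "cover_lattice n E = {C \<inter> x_class n | C. minimal_vertex_cover (vertices n) E C}"

end

theory Submission
  imports Defs
begin

text \<open>
  Write \<open>i \<rightarrow> j\<close> for \<open>{XV i, YV j} \<in> E\<close>; the standing convention makes this relation reflexive.
  The class of all \<open>y\<close>'s is a minimal vertex cover, so \<open>E\<close> is unmixed iff every minimal
  cover contains exactly one of \<open>XV i\<close>, \<open>YV i\<close> for each \<open>i\<close>, and this happens iff \<open>\<rightarrow>\<close> is
  transitive. For such \<open>E\<close> the members of the cover lattice are precisely the sets closed under
  predecessors of the preorder \<open>\<rightarrow>\<close>. The preorder is recovered from them: \<open>i \<rightarrow> j\<close> iff every
  member containing \<open>XV j\<close> contains \<open>XV i\<close>. Conversely, a sublattice with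
  bottom and top consists of all predecessor-closed sets of the preorder it induces in this way,
  since each such set is the union of the least members around its points.
\<close>

section \<open>Vertex covers of a bipartite graph with a fixed perfect matching\<close>

locale matched_bipartite =
  fixes n :: nat and E :: "vertex set set"
  assumes edgeE: "e \<in> E \<Longrightarrow> \<exists>i\<in>{1..n}. \<exists>j\<in>{1..n}. e = {XV i, YV j}"
    and matching: "i \<in> {1..n} \<Longrightarrow> {XV i, YV i} \<in> E"
begin

text \<open>Only "not both" is stated: a vertex cover meets every matching edge, so for covers this
  amounts to exactly one of \<open>XV i\<close> and \<open>YV i\<close>.\<close>

definition transversal :: "vertex set \<Rightarrow> bool" where
  "transversal C \<longleftrightarrow> (\<forall>i\<in>{1..n}. \<not> (XV i \<in> C \<and> YV i \<in> C))"

lemma edge_indices: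
  assumes "{XV i, YV j} \<in> E"
  shows "i \<in> {1..n}" "j \<in> {1..n}"
  using edgeE[OF assms] by (auto simp: doubleton_eq_iff)

lemma in_vertices_iff [simp]:
  "XV i \<in> vertices n \<longleftrightarrow> i \<in> {1..n}" "YV i \<in> vertices n \<longleftrightarrow> i \<in> {1..n}"
  by (auto simp: vertices_def x_class_def y_class_def)

lemma vertex_cover_iff:
  "vertex_cover (vertices n) E C \<longleftrightarrow>
     C \<subseteq> vertices n \<and> (\<forall>i j. {XV i, YV j} \<in> E \<longrightarrow> XV i \<in> C \<or> YV j \<in> C)"
  unfolding vertex_cover_def using edgeE by (fastforce simp: Ball_def)

lemma finite_vertices: "finite (vertices n)"
  by (auto simp: vertices_def x_class_def y_class_def)

text \<open>The index sets of the x-part and the y-part together exhaust \<open>{1..n}\<close>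
  because of the matching, so the excess over \<open>n\<close> is the size of their overlap.\<close>

lemma vertex_cover_card:
  assumes "vertex_cover (vertices n) E C"
  shows "card C = n + card {i\<in>{1..n}. XV i \<in> C \<and> YV i \<in> C}"
proof -
  let ?A = "{i\<in>{1..n}. XV i \<in> C}" and ?B = "{i\<in>{1..n}. YV i \<in> C}"
  have "C = XV ` ?A \<union> YV ` ?B"
    using assms unfolding vertex_cover_def vertices_def x_class_def y_class_def by blast
  then have "card C = card (XV ` ?A \<union> YV ` ?B)" by (rule arg_cong)
  also have "\<dots> = card (XV ` ?A) + card (YV ` ?B)"
    by (intro card_Un_disjoint) auto
  also have "\<dots> = card ?A + card ?B"
    by (simp add: card_image inj_on_def)
  also have "\<dots> = card (?A \<union> ?B) + card (?A \<inter> ?B)"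
    by (rule card_Un_Int) auto
  also have "?A \<union> ?B = {1..n}"
    using assms matching unfolding vertex_cover_iff by blast
  also have "?A \<inter> ?B = {i\<in>{1..n}. XV i \<in> C \<and> YV i \<in> C}" by auto
  finally show ?thesis by simp
qed

lemma vertex_cover_card_eq_iff:
  assumes "vertex_cover (vertices n) E C"
  shows "card C = n \<longleftrightarrow> transversal C"
  using vertex_cover_card[OF assms] by (auto simp: transversal_def)

text \<open>Every cover has at least \<open>n\<close> elements and a transversal one has exactly
  \<open>n\<close>, so no proper subset of it can cover.\<close>

lemma transversal_cover_minimal:
  assumes C: "vertex_cover (vertices n) E C" and "transversal C"
  shows "minimal_vertex_cover (vertices n) E C"
  unfolding minimal_vertex_cover_def
proof (intro conjI allI impI notI)
  fix D assume "D \<subset> C" and D: "vertex_cover (vertices n) E D"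
  have "finite C"
    using C finite_subset finite_vertices by (auto simp: vertex_cover_def)
  then have "card D < card C" using \<open>D \<subset> C\<close> by (rule psubset_card_mono)
  moreover have "card C = n" using assms vertex_cover_card_eq_iff by blast
  ultimately show False using vertex_cover_card[OF D] by simp
qed (rule C)

lemma y_class_minimal: "minimal_vertex_cover (vertices n) E (y_class n)"
proof (rule transversal_cover_minimal)
  show "vertex_cover (vertices n) E (y_class n)"
    using edge_indices unfolding vertex_cover_iff by (auto simp: vertices_def y_class_def)
qed (auto simp: transversal_def y_class_def)

text \<open>The minimal cover \<open>y_class n\<close> fixes the common cardinality as
  \<open>n\<close>, and the covers of that size are the transversal ones.\<close>

lemma unmixed_iff_transversal:
  "unmixed (vertices n) E \<longleftrightarrow>
     (\<forall>C. minimal_vertex_cover (vertices n) E C \<longrightarrow> transversal C)"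
proof -
  have "transversal (y_class n)" by (auto simp: transversal_def y_class_def)
  then have "card (y_class n) = n"
    using y_class_minimal vertex_cover_card_eq_iff by (auto simp: minimal_vertex_cover_def)
  then show ?thesis
    using y_class_minimal vertex_cover_card_eq_iff
    unfolding unmixed_def minimal_vertex_cover_def by metis
qed

lemma minimal_vertex_cover_below:
  assumes "vertex_cover (vertices n) E C"
  obtains D where "D \<subseteq> C" "minimal_vertex_cover (vertices n) E D"
proof -
  have "finite {D. vertex_cover (vertices n) E D}"
    by (rule finite_subset[of _ "Pow (vertices n)"])
      (auto simp: vertex_cover_def finite_vertices)
  from finite_has_minimal2[OF this, of C] assms
  obtain D where "D \<subseteq> C" "vertex_cover (vertices n) E D"
    "\<And>B. vertex_cover (vertices n) E B \<Longrightarrow> B \<subseteq> D \<Longrightarrow> D = B" by auto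
  then show ?thesis using that unfolding minimal_vertex_cover_def by blast
qed

lemma unmixed_iff_transitive:
  "unmixed (vertices n) E \<longleftrightarrow>
     (\<forall>i j k. {XV i, YV j} \<in> E \<longrightarrow> {XV j, YV k} \<in> E \<longrightarrow> {XV i, YV k} \<in> E)"
  unfolding unmixed_iff_transversal
proof (intro iffI allI impI)
  fix i j k
  assume tr: "\<forall>C. minimal_vertex_cover (vertices n) E C \<longrightarrow> transversal C"
    and ij: "{XV i, YV j} \<in> E" and jk: "{XV j, YV k} \<in> E"
  show "{XV i, YV k} \<in> E"
  proof (rule ccontr)
    assume "{XV i, YV k} \<notin> E"
    \<comment> \<open>Only an edge with both ends in \<open>{XV i, YV k}\<close> could be missed. A
      minimal cover inside this set omits \<open>XV i\<close> and \<open>YV k\<close>, so the two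
      given edges force both \<open>YV j\<close> and \<open>XV j\<close> into it.\<close>
    then have "vertex_cover (vertices n) E (vertices n - {XV i, YV k})"
      using edge_indices by (auto simp: vertex_cover_iff)
    then obtain D where D: "D \<subseteq> vertices n - {XV i, YV k}"
        "minimal_vertex_cover (vertices n) E D"
      by (rule minimal_vertex_cover_below)
    then have "YV j \<in> D" "XV j \<in> D"
      using ij jk by (auto simp: minimal_vertex_cover_def vertex_cover_iff)
    moreover have "transversal D" using tr D by blast
    ultimately show False
      using edge_indices[OF jk] by (auto simp: transversal_def)
  qed
next
  fix C
  assume trans: "\<forall>i j k. {XV i, YV j} \<in> E \<longrightarrow> {XV j, YV k} \<in> E \<longrightarrow> {XV i, YV k} \<in> E"
    and C: "minimal_vertex_cover (vertices n) E C"
  then have cover: "vertex_cover (vertices n) E C" by (simp add: minimal_vertex_cover_def)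
  have needed: "\<not> vertex_cover (vertices n) E (C - {v})" if "v \<in> C" for v
    using C that unfolding minimal_vertex_cover_def by blast
  show "transversal C"
    unfolding transversal_def
  proof (intro ballI notI)
    fix j assume j: "XV j \<in> C \<and> YV j \<in> C"
    \<comment> \<open>By minimality \<open>XV j\<close> and \<open>YV j\<close> each have a
      neighbour outside \<open>C\<close>; transitivity joins these two neighbours by an edge that
      \<open>C\<close> does not cover.\<close>
    obtain k where k: "{XV j, YV k} \<in> E" "YV k \<notin> C"
      using needed[of "XV j"] j cover unfolding vertex_cover_iff by blast
    obtain i where i: "{XV i, YV j} \<in> E" "XV i \<notin> C"
      using needed[of "YV j"] j cover unfolding vertex_cover_iff by blast
    show False using trans i k cover unfolding vertex_cover_iff by blast
  qed
qed

text \<open>For a transversal cover, \<open>YV j\<close> is absent whenever \<open>XV j\<close> is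
  present, so covering the edges turns into closure of the x-part under predecessors.\<close>

lemma cover_lattice_eq:
  assumes "unmixed (vertices n) E"
  shows "cover_lattice n E =
    {S. S \<subseteq> x_class n \<and> (\<forall>i j. {XV i, YV j} \<in> E \<longrightarrow> XV j \<in> S \<longrightarrow> XV i \<in> S)}"
    (is "_ = ?R")
proof (intro equalityI subsetI)
  fix S assume "S \<in> cover_lattice n E"
  then obtain C where C: "S = C \<inter> x_class n" "minimal_vertex_cover (vertices n) E C"
    by (auto simp: cover_lattice_def)
  then have "transversal C" using assms by (auto simp: unmixed_iff_transversal)
  have "XV i \<in> S" if e: "{XV i, YV j} \<in> E" and "XV j \<in> S" for i j
  proof -
    have "YV j \<notin> C"
      using \<open>transversal C\<close> \<open>XV j \<in> S\<close> C(1) edge_indices[OF e] by (auto simp: transversal_def)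
    then have "XV i \<in> C"
      using C(2) e by (auto simp: minimal_vertex_cover_def vertex_cover_iff)
    then show ?thesis using C(1) edge_indices[OF e] by (simp add: x_class_def)
  qed
  then show "S \<in> ?R" using C(1) by blast
next
  fix S assume S: "S \<in> ?R"
  \<comment> \<open>The x-part determines a transversal cover: the y's are those of the
    complementary indices.\<close>
  let ?C = "S \<union> {YV i | i. i \<in> {1..n} \<and> XV i \<notin> S}"
  have "vertex_cover (vertices n) E ?C"
    using S edge_indices unfolding vertex_cover_iff by (auto simp: vertices_def y_class_def)
  moreover have "transversal ?C"
    using S by (auto simp: transversal_def x_class_def)
  ultimately have "minimal_vertex_cover (vertices n) E ?C"
    by (rule transversal_cover_minimal)
  moreover have "S = ?C \<inter> x_class n" using S by (auto simp: x_class_def)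
  ultimately show "S \<in> cover_lattice n E" unfolding cover_lattice_def by blast
qed

lemma edge_iff_cover_lattice:
  assumes "unmixed (vertices n) E" "i \<in> {1..n}" "j \<in> {1..n}"
  shows "{XV i, YV j} \<in> E \<longleftrightarrow> (\<forall>S\<in>cover_lattice n E. XV j \<in> S \<longrightarrow> XV i \<in> S)"
proof
  assume all: "\<forall>S\<in>cover_lattice n E. XV j \<in> S \<longrightarrow> XV i \<in> S"
  \<comment> \<open>The test set is the principal down-set of \<open>j\<close>: closed by
    transitivity, and containing \<open>XV j\<close> by the matching.\<close>
  have "XV ` {k. {XV k, YV j} \<in> E} \<in> cover_lattice n E"
  proof -
    have "XV ` {k. {XV k, YV j} \<in> E} \<subseteq> x_class n"
      unfolding x_class_def using edge_indices(1) by (intro image_mono) blast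
    moreover have "{XV i, YV j} \<in> E" if "{XV i, YV k} \<in> E" "{XV k, YV j} \<in> E" for i k
      using assms(1) that unfolding unmixed_iff_transitive by blast
    ultimately show ?thesis by (simp add: cover_lattice_eq[OF assms(1)] image_iff)
  qed
  from bspec[OF all this] show "{XV i, YV j} \<in> E"
    using matching[OF assms(3)] by (simp add: image_iff)
qed (auto simp: cover_lattice_eq[OF assms(1)])

lemma sublattice_cover_lattice:
  assumes "unmixed (vertices n) E"
  shows "{} \<in> cover_lattice n E" "x_class n \<in> cover_lattice n E"
    "sublattice (cover_lattice n E) (boolean_lattice n)"
  using edge_indices
  by (auto simp: cover_lattice_eq[OF assms] sublattice_def boolean_lattice_def x_class_def)

end

section \<open>The correspondence between unmixed graphs and sublattices\<close>

lemma unmixed_bipartite_graph_iff: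
  "unmixed_bipartite_graph n E \<longleftrightarrow> matched_bipartite n E \<and> unmixed (vertices n) E"
proof
  assume "unmixed_bipartite_graph n E"
  then show "matched_bipartite n E \<and> unmixed (vertices n) E"
    by (auto simp: unmixed_bipartite_graph_def bipartition_def matched_bipartite_def
        x_class_def y_class_def)
next
  assume "matched_bipartite n E \<and> unmixed (vertices n) E"
  then interpret matched_bipartite n E by simp
  have "simple_graph (vertices n) E"
    using edgeE finite_vertices by (fastforce simp: simple_graph_def)
  moreover have "no_isolated_vertices (vertices n) E"
    unfolding no_isolated_vertices_def
  proof
    fix v assume "v \<in> vertices n"
    then obtain i where "i \<in> {1..n}" "v \<in> {XV i, YV i}"
      by (auto simp: vertices_def x_class_def y_class_def)
    then show "\<exists>e\<in>E. v \<in> e" using matching by (intro bexI[of _ "{XV i, YV i}"])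
  qed
  moreover have "bipartition (vertices n) E (x_class n) (y_class n)"
    using edgeE by (fastforce simp: bipartition_def vertices_def x_class_def y_class_def)
  ultimately show "unmixed_bipartite_graph n E"
    using \<open>matched_bipartite n E \<and> _\<close> matching by (simp add: unmixed_bipartite_graph_def)
qed

text \<open>Intended inverse of \<open>cover_lattice\<close>. With the members of \<open>L\<close>
  read as closed sets, the edges form the specialization preorder: \<open>XV i\<close> lies in the
  closure of \<open>XV j\<close>.\<close>

definition lattice_graph :: "nat \<Rightarrow> vertex set set \<Rightarrow> vertex set set" where
  "lattice_graph n L = {{XV i, YV j} | i j. i \<in> {1..n} \<and> j \<in> {1..n} \<and>
     (\<forall>S\<in>L. XV j \<in> S \<longrightarrow> XV i \<in> S)}"

lemma lattice_graph_edge_iff: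
  "{XV i, YV j} \<in> lattice_graph n L \<longleftrightarrow>
     i \<in> {1..n} \<and> j \<in> {1..n} \<and> (\<forall>S\<in>L. XV j \<in> S \<longrightarrow> XV i \<in> S)"
  by (auto simp: lattice_graph_def doubleton_eq_iff)

lemma matched_bipartite_lattice_graph: "matched_bipartite n (lattice_graph n L)"
proof
  show "\<exists>i\<in>{1..n}. \<exists>j\<in>{1..n}. e = {XV i, YV j}" if "e \<in> lattice_graph n L" for e
    using that unfolding lattice_graph_def by blast
qed (simp add: lattice_graph_edge_iff)

lemma unmixed_lattice_graph: "unmixed (vertices n) (lattice_graph n L)"
  by (simp add: matched_bipartite.unmixed_iff_transitive[OF matched_bipartite_lattice_graph]
      lattice_graph_edge_iff)

text \<open>Makes \<open>cover_lattice n\<close> injective on these graphs, which yields uniqueness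
  in the theorem.\<close>

lemma unmixed_bipartite_graph_unique:
  assumes "unmixed_bipartite_graph n E"
  shows "E = lattice_graph n (cover_lattice n E)"
proof -
  interpret matched_bipartite n E using assms by (simp add: unmixed_bipartite_graph_iff)
  have *: "\<And>i j. i \<in> {1..n} \<Longrightarrow> j \<in> {1..n} \<Longrightarrow>
      {XV i, YV j} \<in> E \<longleftrightarrow> (\<forall>S\<in>cover_lattice n E. XV j \<in> S \<longrightarrow> XV i \<in> S)"
    using assms by (intro edge_iff_cover_lattice) (simp_all add: unmixed_bipartite_graph_iff)
  show ?thesis
  proof (intro equalityI subsetI)
    fix e assume "e \<in> E"
    with edgeE obtain i j where "i \<in> {1..n}" "j \<in> {1..n}" "e = {XV i, YV j}" by blast
    with \<open>e \<in> E\<close> * show "e \<in> lattice_graph n (cover_lattice n E)"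
      by (simp add: lattice_graph_edge_iff)
  next
    fix e assume "e \<in> lattice_graph n (cover_lattice n E)"
    then show "e \<in> E" using * unfolding lattice_graph_def by blast
  qed
qed

text \<open>\<open>F\<close> must be nonempty because the empty intersection is
  \<open>UNIV\<close>.\<close>

lemma sublattice_Inter:
  assumes "sublattice L M" "finite F" "F \<noteq> {}" "F \<subseteq> L"
  shows "\<Inter>F \<in> L"
  using assms(2-4) by (induction F rule: finite_ne_induct)
    (use assms(1) in \<open>auto simp: sublattice_def\<close>)

lemma sublattice_Union:
  assumes "sublattice L M" "{} \<in> L" "finite F" "F \<subseteq> L"
  shows "\<Union>F \<in> L"
  using assms(3,4) by (induction F rule: finite_induct)
    (use assms(1,2) in \<open>auto simp: sublattice_def\<close>)

lemma cover_lattice_lattice_graph: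
  assumes "{} \<in> L" "x_class n \<in> L" and L: "sublattice L (boolean_lattice n)"
  shows "cover_lattice n (lattice_graph n L) = L"
proof -
  have sub: "S \<subseteq> x_class n" if "S \<in> L" for S
    using L that by (auto simp: sublattice_def boolean_lattice_def)
  have fin: "finite L"
    by (rule finite_subset[of _ "Pow (x_class n)"]) (use sub in \<open>auto simp: x_class_def\<close>)
  have eq: "cover_lattice n (lattice_graph n L) =
    {S. S \<subseteq> x_class n \<and> (\<forall>i j. {XV i, YV j} \<in> lattice_graph n L \<longrightarrow> XV j \<in> S \<longrightarrow> XV i \<in> S)}"
    by (rule matched_bipartite.cover_lattice_eq
        [OF matched_bipartite_lattice_graph unmixed_lattice_graph])
  show ?thesis
  proof (intro equalityI subsetI)
    fix S assume S: "S \<in> cover_lattice n (lattice_graph n L)"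
    define least where "least v = \<Inter>{T\<in>L. v \<in> T}" for v
    have Sx: "S \<subseteq> x_class n" using S by (simp add: eq)
    have least: "least v \<in> L" if "v \<in> S" for v
      \<comment> \<open>The top element \<open>x_class n\<close> contains \<open>v\<close>, so the
        intersected family is nonempty.\<close>
      unfolding least_def
      by (rule sublattice_Inter[OF L]) (use fin assms(2) Sx that in auto)
    have "least v \<subseteq> S" if "v \<in> S" for v
    proof
      fix u assume u: "u \<in> least v"
      then have "u \<in> x_class n" "v \<in> x_class n" using sub[OF least[OF that]] Sx that by blast+
      then obtain i j where "u = XV i" "v = XV j" "i \<in> {1..n}" "j \<in> {1..n}"
        by (auto simp: x_class_def)
      \<comment> \<open>Membership of \<open>XV i\<close> in the least member around
        \<open>XV j\<close> is exactly the edge condition.\<close>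
      moreover from this u have "{XV i, YV j} \<in> lattice_graph n L"
        by (simp add: least_def lattice_graph_edge_iff)
      ultimately show "u \<in> S" using S that unfolding eq by blast
    qed
    moreover have "v \<in> least v" for v by (simp add: least_def)
    ultimately have "S = \<Union>(least ` S)" by blast
    moreover have "finite S" using Sx by (rule finite_subset) (simp add: x_class_def)
    ultimately show "S \<in> L"
      using sublattice_Union[OF L assms(1), of "least ` S"] least by auto
  next
    fix S assume "S \<in> L"
    then show "S \<in> cover_lattice n (lattice_graph n L)"
      using sub by (auto simp: eq lattice_graph_edge_iff)
  qed
qed

theorem theorem1p2:
  fixes n :: nat and L :: "vertex set set"
  assumes "n \<ge> 1" and "L \<subseteq> boolean_lattice n"
  shows "(\<exists>!E. unmixed_bipartite_graph n E \<and> L = cover_lattice n E) \<longleftrightarrow>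
         {} \<in> L \<and> x_class n \<in> L \<and> sublattice L (boolean_lattice n)"
proof
  assume "\<exists>!E. unmixed_bipartite_graph n E \<and> L = cover_lattice n E"
  then obtain E where "matched_bipartite n E" "unmixed (vertices n) E" "L = cover_lattice n E"
    by (auto simp: unmixed_bipartite_graph_iff)
  then show "{} \<in> L \<and> x_class n \<in> L \<and> sublattice L (boolean_lattice n)"
    by (simp add: matched_bipartite.sublattice_cover_lattice)
next
  assume "{} \<in> L \<and> x_class n \<in> L \<and> sublattice L (boolean_lattice n)"
  then have "cover_lattice n (lattice_graph n L) = L"
    by (simp add: cover_lattice_lattice_graph)
  moreover have "unmixed_bipartite_graph n (lattice_graph n L)"
    by (simp add: unmixed_bipartite_graph_iff matched_bipartite_lattice_graph
        unmixed_lattice_graph)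
  \<comment> \<open>Any other solution \<open>E\<close> equals
    \<open>lattice_graph n (cover_lattice n E)\<close>, hence
    \<open>lattice_graph n L\<close>.\<close>
  ultimately show "\<exists>!E. unmixed_bipartite_graph n E \<and> L = cover_lattice n E"
    using unmixed_bipartite_graph_unique by (intro ex1I[of _ "lattice_graph n L"]) auto
qed

end
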